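(* For a coherent quantale $A$ the following are equivalent: (1) $A$ is a $PF$-quantale; (2) $A$ is a semiprime $mp$-quantale.
   Context: A quantale here means a complete lattice $A$ with bottom $0$ and top $1$, with an associative commutative multiplication that distributes over arbitrary joins and has $1$ as unit. $K(A)$ is the set of compact elements. $A$ is coherent if every element is a join of compact elements, $1\in K(A)$, and $K(A)$ is closed under multiplication. An element $p<1$ is $m$-prime if for all $a,b\in A$, $ab\leq p$ implies $a\leq p$ or $b\leq p$; $Spec(A)$ is the set of $m$-prime elements and $Min(A)$ is the set of minimal elements of $Spec(A)$. $\rho(a)=\bigwedge\{p\in Spec(A): a\leq p\}$; $A$ is semiprime if $\rho(0)=0$. $A$ is an $mp$-quantale if for any $p\in Spec(A)$ there exists a unique $q\in Min(A)$ with $q\leq p$. $a^{\perp}=\bigvee\{x\in A: ax=0\}$. An element $a\in A$ is pure if for all $c\in K(A)$, $c\leq a$ implies $a\vee c^{\perp}=1$. $A$ is a $PF$-quantale if $c^{\perp}$ is pure for each $c\in K(A)$. *)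

theory Defs
  imports Main
begin

definition compact_elements :: "'a::complete_lattice set" where
  "compact_elements =
    {c. \<forall>X. c \<le> Sup X \<longrightarrow> (\<exists>F. finite F \<and> F \<subseteq> X \<and> c \<le> Sup F)}"

text \<open>
  Quantales here are commutative and integral: the unit of the multiplication is the top
  element, which plays the role of 1, and the bottom element plays the role of 0.
  The underlying complete lattice is the whole type; it is not assumed to be nontrivial.
\<close>

locale quantale = comm_monoid mult top
  for mult :: "'a::complete_lattice \<Rightarrow> 'a \<Rightarrow> 'a"  (infixl "\<cdot>" 70) +
  assumes mult_Sup: "a \<cdot> Sup X = Sup {a \<cdot> x | x. x \<in> X}"
begin

definition Spec :: "'a set" where
  "Spec = {p. p < top \<and> (\<forall>a b. a \<cdot> b \<le> p \<longrightarrow> a \<le> p \<or> b \<le> p)}"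

definition Min_Spec :: "'a set" where
  "Min_Spec = {q \<in> Spec. \<forall>p \<in> Spec. p \<le> q \<longrightarrow> p = q}"

text \<open>As usual, the meet over the empty set is top.\<close>

definition radical :: "'a \<Rightarrow> 'a" where
  "radical a = Inf {p \<in> Spec. a \<le> p}"

definition annihilator :: "'a \<Rightarrow> 'a" where
  "annihilator a = Sup {x. a \<cdot> x = bot}"

definition pure :: "'a \<Rightarrow> bool" where
  "pure a \<longleftrightarrow> (\<forall>c \<in> compact_elements. c \<le> a \<longrightarrow> sup a (annihilator c) = top)"

end

locale coherent_quantale = quantale mult
  for mult :: "'a::complete_lattice \<Rightarrow> 'a \<Rightarrow> 'a"  (infixl "\<cdot>" 70) +
  assumes join_of_compact: "\<exists>X \<subseteq> compact_elements. (a::'a) = Sup X"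
    and top_compact: "(top::'a) \<in> compact_elements"
    and mult_compact:
      "c \<in> compact_elements \<Longrightarrow> d \<in> compact_elements \<Longrightarrow> c \<cdot> d \<in> compact_elements"

locale semiprime_quantale = quantale mult
  for mult :: "'a::complete_lattice \<Rightarrow> 'a \<Rightarrow> 'a"  (infixl "\<cdot>" 70) +
  assumes radical_bot: "radical bot = bot"

locale mp_quantale = quantale mult
  for mult :: "'a::complete_lattice \<Rightarrow> 'a \<Rightarrow> 'a"  (infixl "\<cdot>" 70) +
  assumes unique_minimal: "p \<in> Spec \<Longrightarrow> \<exists>!q. q \<in> Min_Spec \<and> q \<le> p"

locale PF_quantale = quantale mult
  for mult :: "'a::complete_lattice \<Rightarrow> 'a \<Rightarrow> 'a"  (infixl "\<cdot>" 70) +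
  assumes annihilator_pure: "c \<in> compact_elements \<Longrightarrow> pure (annihilator c)"

end

theory Submission
  imports Defs
begin

text \<open>
  Minimal primes are reached by Krull's separation argument: an element below which no member of
  a nonempty multiplicative set of compact elements lies is below a prime with the same property.
  Applied to the elements \<open>c\<^sup>n \<cdot> s\<close> with \<open>s\<close> compact and not below a prime \<open>p\<close>, it shows that in
  a semiprime coherent quantale \<open>c\<^sup>\<bottom> \<le> p\<close> iff some prime below \<open>p\<close> avoids \<open>c\<close>.  Hence the
  failure of \<open>c\<^sup>\<bottom> \<squnion> d\<^sup>\<bottom> = 1\<close> for some \<open>c \<cdot> d = 0\<close> amounts to two distinct minimal primes
  below a common prime.  A \<open>PF\<close>-quantale is semiprime because \<open>c \<cdot> c = 0\<close> gives \<open>c \<le> c\<^sup>\<bottom>\<close>, whence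
  \<open>c\<^sup>\<bottom> = 1\<close> by purity and \<open>c = 0\<close>.
\<close>

text \<open>The finite subfamily provided by compactness has its maximum as join. If it is empty,
  then \<open>c\<close> is \<open>bot\<close>, and any member of the nonempty chain will do.\<close>

lemma compact_le_chain_Sup:
  assumes "c \<in> compact_elements" "c \<le> Sup C" "C \<noteq> {}"
    and chain: "\<And>x y. x \<in> C \<Longrightarrow> y \<in> C \<Longrightarrow> x \<le> y \<or> y \<le> x"
  shows "\<exists>x\<in>C. c \<le> x"
proof -
  obtain F where F: "finite F" "F \<subseteq> C" "c \<le> Sup F"
    using assms(1,2) unfolding compact_elements_def by blast
  show ?thesis
  proof (cases "F = {}")
    case True
    with F(3) have "c \<le> x" for x by (metis Sup_empty bot.extremum order_trans)
    with \<open>C \<noteq> {}\<close> show ?thesis by blast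
  next
    case False
    have "Sup F \<in> F"
      by (rule in_chain_finite[OF _ F(1) False]) (use F(2) chain in \<open>auto simp: chain_def\<close>)
    with F show ?thesis by blast
  qed
qed

section \<open>Multiplication and annihilators\<close>

context quantale
begin

lemma mult_mono_right: "x \<le> y \<Longrightarrow> a \<cdot> x \<le> a \<cdot> y"
proof -
  assume "x \<le> y"
  then have "Sup {x, y} = y" by (simp add: sup_absorb2)
  then have "a \<cdot> y = Sup {a \<cdot> z | z. z \<in> {x, y}}" using mult_Sup[of a "{x, y}"] by simp
  then show ?thesis by (metis (mono_tags, lifting) Sup_upper insertI1 mem_Collect_eq)
qed

lemma mult_mono: "x \<le> y \<Longrightarrow> a \<le> b \<Longrightarrow> x \<cdot> a \<le> y \<cdot> b"
  by (metis commute mult_mono_right order_trans)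

lemma mult_le_left: "x \<cdot> y \<le> x"
  by (metis mult_mono_right comm_neutral top_greatest)

lemma mult_le_right: "x \<cdot> y \<le> y"
  by (metis commute mult_le_left)

lemma mult_sup: "a \<cdot> sup x y = sup (a \<cdot> x) (a \<cdot> y)"
proof -
  have "{a \<cdot> z | z. z \<in> {x, y}} = {a \<cdot> x, a \<cdot> y}" by auto
  then show ?thesis using mult_Sup[of a "{x, y}"] by simp
qed

text \<open>Three of the four products in the expansion have a factor \<open>p\<close> and are
  absorbed by it. This is what makes maximal avoiding elements prime.\<close>

lemma sup_mult_sup_le: "sup p a \<cdot> sup p b \<le> sup p (a \<cdot> b)"
proof -
  have "sup p a \<cdot> sup p b = sup (sup p a \<cdot> p) (sup (b \<cdot> p) (a \<cdot> b))"
    by (simp add: mult_sup commute[of "sup p a" b] commute[of a b])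
  then show ?thesis
    by (simp add: le_supI1 mult_le_right)
qed

text \<open>Distributivity over arbitrary joins passes from the elements killed by \<open>a\<close>
  to their join, so \<open>annihilator a\<close> is the largest of them.\<close>

lemma mult_annihilator: "a \<cdot> annihilator a = bot"
  by (auto simp: annihilator_def mult_Sup)

lemma le_annihilator_iff: "x \<le> annihilator a \<longleftrightarrow> a \<cdot> x = bot"
proof
  assume "x \<le> annihilator a"
  then show "a \<cdot> x = bot"
    by (metis mult_annihilator mult_mono_right bot.extremum_uniqueI)
qed (simp add: annihilator_def Sup_upper)

section \<open>Primes, separation and minimal primes\<close>

lemma Spec_less_top: "p \<in> Spec \<Longrightarrow> p < top"
  by (simp add: Spec_def)

lemma Spec_mult_le_iff: "p \<in> Spec \<Longrightarrow> a \<cdot> b \<le> p \<longleftrightarrow> a \<le> p \<or> b \<le> p"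
  unfolding Spec_def using mult_le_left mult_le_right order_trans by blast

lemma Spec_annihilator_le: "p \<in> Spec \<Longrightarrow> \<not> c \<le> p \<Longrightarrow> annihilator c \<le> p"
  using Spec_mult_le_iff[of p c "annihilator c"] by (simp add: mult_annihilator)

lemma Min_SpecD: "q \<in> Min_Spec \<Longrightarrow> q \<in> Spec"
  by (simp add: Min_Spec_def)

lemma Min_Spec_eq: "q \<in> Min_Spec \<Longrightarrow> p \<in> Spec \<Longrightarrow> p \<le> q \<Longrightarrow> p = q"
  by (simp add: Min_Spec_def)

text \<open>Zorn's lemma gives an element maximal among those that are above \<open>a\<close> and
  have no member of \<open>S\<close> below them. Multiplicative closure of \<open>S\<close> makes it
  prime.\<close>

lemma separation:
  assumes compact: "S \<subseteq> compact_elements" and "S \<noteq> {}"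
    and closed: "\<And>s t. s \<in> S \<Longrightarrow> t \<in> S \<Longrightarrow> s \<cdot> t \<in> S"
    and a: "\<And>s. s \<in> S \<Longrightarrow> \<not> s \<le> a"
  shows "\<exists>p\<in>Spec. a \<le> p \<and> (\<forall>s\<in>S. \<not> s \<le> p)"
proof -
  define A where "A = {x. a \<le> x \<and> (\<forall>s\<in>S. \<not> s \<le> x)}"
  have po: "partial_order_on A (relation_of (\<le>) A)"
    by (rule partial_order_on_relation_ofI) auto
  have "\<exists>u\<in>A. \<forall>x\<in>C. x \<le> u" if C: "C \<in> Chains (relation_of (\<le>) A)" for C
  proof (cases "C = {}")
    case True
    have "a \<in> A" using a by (simp add: A_def)
    with True show ?thesis by blast
  next
    case False
    have sub: "C \<subseteq> A" and chain: "\<And>x y. x \<in> C \<Longrightarrow> y \<in> C \<Longrightarrow> x \<le> y \<or> y \<le> x"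
      using C by (auto simp: Chains_def relation_of_def)
    have "\<not> s \<le> Sup C" if "s \<in> S" for s
      using compact_le_chain_Sup[of s C] that compact sub False chain by (auto simp: A_def)
    moreover have "a \<le> Sup C"
      using False sub by (metis (lifting) A_def Sup_upper2 ex_in_conv mem_Collect_eq subset_iff)
    ultimately have "Sup C \<in> A" by (simp add: A_def)
    then show ?thesis by (meson Sup_upper)
  qed
  from predicate_Zorn[OF po this] obtain p
    where p: "p \<in> A" and max: "\<And>x. x \<in> A \<Longrightarrow> p \<le> x \<Longrightarrow> x = p" by blast
  \<comment> \<open>Otherwise \<open>sup p x\<close> would be in \<open>A\<close> and strictly above
    the maximal element \<open>p\<close>.\<close>
  have outside: "\<exists>s\<in>S. s \<le> sup p x" if "\<not> x \<le> p" for x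
  proof (rule ccontr)
    assume "\<not> (\<exists>s\<in>S. s \<le> sup p x)"
    then have "sup p x \<in> A" using p by (auto simp: A_def intro: le_supI1)
    with max that show False by (metis sup_ge1 sup_ge2)
  qed
  have "p \<in> Spec"
    unfolding Spec_def
  proof (intro CollectI conjI allI impI)
    show "p < top"
      using \<open>S \<noteq> {}\<close> p by (auto simp: A_def less_top[symmetric])
    fix x y assume le: "x \<cdot> y \<le> p"
    show "x \<le> p \<or> y \<le> p"
    proof (rule ccontr)
      assume "\<not> (x \<le> p \<or> y \<le> p)"
      then obtain s t where st: "s \<in> S" "t \<in> S" "s \<le> sup p x" "t \<le> sup p y"
        using outside by meson
      then have "s \<cdot> t \<le> sup p x \<cdot> sup p y" by (intro mult_mono)
      also have "\<dots> \<le> p" using sup_mult_sup_le[of p x y] le by (simp add: sup_absorb1)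
      finally show False using closed[OF st(1,2)] p by (auto simp: A_def)
    qed
  qed
  with p show ?thesis by (auto simp: A_def)
qed

text \<open>If \<open>a\<close> escapes one member of the chain and \<open>b\<close> another, both
  escape the smaller of the two. Nonemptiness keeps the meet below \<open>top\<close>.\<close>

lemma Inf_chain_Spec:
  assumes "C \<subseteq> Spec" "C \<noteq> {}" and chain: "\<And>x y. x \<in> C \<Longrightarrow> y \<in> C \<Longrightarrow> x \<le> y \<or> y \<le> x"
  shows "Inf C \<in> Spec"
  unfolding Spec_def
proof (intro CollectI conjI allI impI)
  show "Inf C < top"
    using assms(1,2) Spec_less_top by (metis Inf_lower ex_in_conv order_le_less_trans subsetD)
  fix a b assume ab: "a \<cdot> b \<le> Inf C"
  show "a \<le> Inf C \<or> b \<le> Inf C"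
  proof (rule ccontr)
    assume "\<not> (a \<le> Inf C \<or> b \<le> Inf C)"
    then obtain x y where xy: "x \<in> C" "y \<in> C" "\<not> a \<le> x" "\<not> b \<le> y"
      by (auto simp: le_Inf_iff)
    then obtain z where "z \<in> C" "\<not> a \<le> z" "\<not> b \<le> z"
      using chain[of x y] order_trans by blast
    moreover have "a \<cdot> b \<le> z" using ab \<open>z \<in> C\<close> by (simp add: le_Inf_iff)
    ultimately show False using assms(1) Spec_mult_le_iff by blast
  qed
qed

lemma Min_Spec_below:
  assumes "p \<in> Spec"
  shows "\<exists>q\<in>Min_Spec. q \<le> p"
proof -
  define A where "A = {x \<in> Spec. x \<le> p}"
  \<comment> \<open>Zorn's lemma is applied to the reversed order. Minimality among the primes below
    \<open>p\<close> is minimality in \<open>Spec\<close>, since a prime below a member of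
    \<open>A\<close> is again in \<open>A\<close>.\<close>
  have po: "partial_order_on A (relation_of (\<ge>) A)"
    by (rule partial_order_on_relation_ofI) auto
  have "\<exists>u\<in>A. \<forall>x\<in>C. x \<ge> u" if C: "C \<in> Chains (relation_of (\<ge>) A)" for C
  proof (cases "C = {}")
    case True
    with assms show ?thesis by (auto simp: A_def)
  next
    case False
    have sub: "C \<subseteq> A" and chain: "\<And>x y. x \<in> C \<Longrightarrow> y \<in> C \<Longrightarrow> x \<le> y \<or> y \<le> x"
      using C by (auto simp: Chains_def relation_of_def)
    have "Inf C \<in> Spec"
      by (rule Inf_chain_Spec) (use sub chain False in \<open>auto simp: A_def\<close>)
    moreover have "Inf C \<le> p"
      using False sub by (metis (lifting) A_def Inf_lower2 ex_in_conv mem_Collect_eq subset_iff)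
    ultimately have "Inf C \<in> A" by (simp add: A_def)
    then show ?thesis by (meson Inf_lower)
  qed
  from predicate_Zorn[OF po this] obtain q
    where q: "q \<in> A" and min: "\<And>x. x \<in> A \<Longrightarrow> x \<le> q \<Longrightarrow> x = q" by blast
  then have "q \<in> Min_Spec" by (auto simp: A_def Min_Spec_def intro: order_trans)
  with q show ?thesis by (auto simp: A_def)
qed

text \<open>Iterating multiplication by \<open>c\<close> encodes the element \<open>c^n\<close>
  times \<open>s\<close>; exponents add under multiplication.\<close>

lemma power_mult_power:
  "((\<cdot>) c ^^ m) s \<cdot> ((\<cdot>) c ^^ n) t = ((\<cdot>) c ^^ (m + n)) (s \<cdot> t)"
proof (induction m)
  case 0
  show ?case by (induction n) (simp_all add: left_commute)
qed (simp add: assoc)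

lemma Spec_power_le_iff:
  "p \<in> Spec \<Longrightarrow> ((\<cdot>) c ^^ n) s \<le> p \<longleftrightarrow> (n > 0 \<and> c \<le> p) \<or> s \<le> p"
  by (induction n) (auto simp: Spec_mult_le_iff)

end

context semiprime_quantale
begin

text \<open>Every prime is above \<open>c\<close> or \<open>s\<close>, hence above their product,
  which therefore lies below the radical of \<open>bot\<close>.\<close>

lemma mult_eq_bot_if_power_eq_bot:
  assumes "((\<cdot>) c ^^ n) s = bot"
  shows "c \<cdot> s = bot"
proof -
  have "c \<cdot> s \<le> p" if "p \<in> Spec" for p
    using Spec_power_le_iff[OF that, of n c s] assms that by (auto simp: Spec_mult_le_iff)
  then have "c \<cdot> s \<le> radical bot"
    unfolding radical_def by (intro Inf_greatest) auto
  then show ?thesis by (simp add: radical_bot bot.extremum_uniqueI)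
qed

end

section \<open>Coherent quantales and the two implications\<close>

context coherent_quantale
begin

lemma le_if_compact_le:
  fixes a b :: 'a
  assumes "\<And>c. c \<in> compact_elements \<Longrightarrow> c \<le> a \<Longrightarrow> c \<le> b"
  shows "a \<le> b"
proof -
  obtain X where X: "X \<subseteq> compact_elements" "a = Sup X" using join_of_compact[of a] by blast
  have "x \<le> b" if "x \<in> X" for x
    using assms[of x] that X by (auto intro: Sup_upper)
  then show ?thesis unfolding X(2) by (rule Sup_least)
qed

lemma power_compact:
  "c \<in> compact_elements \<Longrightarrow> s \<in> compact_elements \<Longrightarrow> ((\<cdot>) c ^^ n) s \<in> compact_elements"
  by (induction n) (auto intro: mult_compact)

lemma ex_Spec_above:
  assumes "a < top"
  shows "\<exists>p\<in>Spec. a \<le> p"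
  \<comment> \<open>Avoiding the multiplicative set \<open>{top}\<close> means being proper.\<close>
  using separation[of "{top}" a] assms top_compact by (auto simp: top_unique)

text \<open>This is the converse of \<open>Spec_annihilator_le\<close> up to passing below
  \<open>p\<close>; minimal primes are controlled through it.\<close>

lemma ex_Spec_below_not_above:
  assumes semiprime: "semiprime_quantale (\<cdot>)"
    and p: "p \<in> Spec" and c: "c \<in> compact_elements" and ann: "annihilator c \<le> p"
  shows "\<exists>q\<in>Spec. q \<le> p \<and> \<not> c \<le> q"
proof -
  interpret semiprime_quantale "(\<cdot>)" by (rule semiprime)
  \<comment> \<open>The members with \<open>n = 0\<close> will force \<open>q\<close> below
    \<open>p\<close>; the member with \<open>n = 1\<close> and \<open>s = top\<close> is
    \<open>c\<close> itself and will keep \<open>c\<close> from lying below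
    \<open>q\<close>.\<close>
  let ?S = "{((\<cdot>) c ^^ n) s | n s. s \<in> compact_elements \<and> \<not> s \<le> p}"
  have "\<exists>q\<in>Spec. bot \<le> q \<and> (\<forall>s\<in>?S. \<not> s \<le> q)"
  proof (rule separation)
    show "?S \<subseteq> compact_elements" using c by (auto intro: power_compact)
    have "\<not> top \<le> p" using Spec_less_top[OF p] by (simp add: less_le_not_le)
    then show "?S \<noteq> {}" using top_compact by blast
    show "x \<cdot> y \<in> ?S" if x: "x \<in> ?S" and y: "y \<in> ?S" for x y
    proof -
      obtain m s where s: "x = ((\<cdot>) c ^^ m) s" "s \<in> compact_elements" "\<not> s \<le> p"
        using x by blast
      obtain n t where t: "y = ((\<cdot>) c ^^ n) t" "t \<in> compact_elements" "\<not> t \<le> p"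
        using y by blast
      have "x \<cdot> y = ((\<cdot>) c ^^ (m + n)) (s \<cdot> t)" by (simp add: s t power_mult_power)
      moreover have "s \<cdot> t \<in> compact_elements" "\<not> s \<cdot> t \<le> p"
        using s t p by (auto simp: mult_compact Spec_mult_le_iff)
      ultimately show ?thesis by blast
    qed
    show "\<not> x \<le> bot" if x: "x \<in> ?S" for x
    proof
      assume "x \<le> bot"
      then obtain n s where "((\<cdot>) c ^^ n) s = bot" "\<not> s \<le> p"
        using x by (smt (verit) bot_unique mem_Collect_eq)
      then have "s \<le> annihilator c"
        by (simp add: le_annihilator_iff mult_eq_bot_if_power_eq_bot)
      with ann \<open>\<not> s \<le> p\<close> show False by (meson order_trans)
    qed
  qed
  then obtain q where q: "q \<in> Spec" and avoid: "\<And>s. s \<in> ?S \<Longrightarrow> \<not> s \<le> q" by blast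
  have "s \<le> p" if "s \<in> compact_elements" "s \<le> q" for s
  proof (rule ccontr)
    assume "\<not> s \<le> p"
    with that have "((\<cdot>) c ^^ 0) s \<in> ?S" by blast
    with avoid that(2) show False by force
  qed
  then have "q \<le> p" by (rule le_if_compact_le)
  moreover have "\<not> c \<le> q"
  proof -
    have "\<not> top \<le> p" using Spec_less_top[OF p] by (simp add: less_le_not_le)
    then have "((\<cdot>) c ^^ 1) top \<in> ?S" using top_compact by blast
    with avoid show ?thesis by force
  qed
  ultimately show ?thesis using q by blast
qed

lemma PF_imp_semiprime:
  assumes "PF_quantale (\<cdot>)"
  shows "semiprime_quantale (\<cdot>)"
proof unfold_locales
  interpret PF_quantale "(\<cdot>)" by (rule assms)
  have reduced: "d = bot" if d: "d \<in> compact_elements" "d \<cdot> d = bot" for d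
  proof -
    have "d \<le> annihilator d" using d by (simp add: le_annihilator_iff)
    then have "annihilator d = top" using annihilator_pure[OF d(1)] d(1)
      by (metis pure_def sup.idem)
    then show ?thesis by (metis mult_annihilator comm_neutral)
  qed
  have "c \<le> bot" if c: "c \<in> compact_elements" "c \<le> radical bot" for c
  proof (rule ccontr)
    assume "\<not> c \<le> bot"
    then have "c \<noteq> bot" by auto
    \<comment> \<open>Index \<open>n\<close> stands for the power \<open>c^(n+1)\<close>, so
      multiplying indices \<open>m\<close> and \<open>n\<close> gives index
      \<open>Suc (m + n)\<close>.\<close>
    let ?S = "{((\<cdot>) c ^^ n) c | n. True}"
    have nz: "((\<cdot>) c ^^ n) c \<noteq> bot" for n
    proof (induction n)
      case (Suc n)
      \<comment> \<open>A nonzero power has nonzero square by \<open>reduced\<close>, and this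
        square lies below the next power.\<close>
      have "((\<cdot>) c ^^ n) c \<cdot> ((\<cdot>) c ^^ n) c \<noteq> bot"
        using Suc reduced power_compact c(1) by blast
      moreover have "((\<cdot>) c ^^ n) c \<cdot> ((\<cdot>) c ^^ n) c \<le> c \<cdot> ((\<cdot>) c ^^ n) c"
        by (rule mult_mono[OF _ order_refl]) (cases n; simp add: mult_le_left)
      ultimately show ?case by (auto simp: bot_unique)
    qed (simp add: \<open>c \<noteq> bot\<close>)
    have "\<exists>q\<in>Spec. bot \<le> q \<and> (\<forall>s\<in>?S. \<not> s \<le> q)"
    proof (rule separation)
      show "?S \<subseteq> compact_elements" using c by (auto intro: power_compact)
      show "x \<cdot> y \<in> ?S" if "x \<in> ?S" "y \<in> ?S" for x y
      proof -
        obtain m n where "x = ((\<cdot>) c ^^ m) c" "y = ((\<cdot>) c ^^ n) c" using \<open>x \<in> ?S\<close> \<open>y \<in> ?S\<close> by blast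
        then have "x \<cdot> y = ((\<cdot>) c ^^ Suc (m + n)) c"
          by (simp add: power_mult_power funpow_swap1)
        then show ?thesis by blast
      qed
    qed (use nz in \<open>auto simp: bot_unique\<close>)
    then obtain q where "q \<in> Spec" "\<not> ((\<cdot>) c ^^ 0) c \<le> q" by blast
    moreover have "c \<le> q" using c(2) \<open>q \<in> Spec\<close> by (simp add: radical_def le_Inf_iff)
    ultimately show False by simp
  qed
  then have "radical bot \<le> bot" by (rule le_if_compact_le)
  then show "radical bot = bot" by (simp add: bot_unique)
qed

lemma PF_imp_mp:
  assumes "PF_quantale (\<cdot>)"
  shows "mp_quantale (\<cdot>)"
proof unfold_locales
  interpret PF_quantale "(\<cdot>)" by (rule assms)
  fix p assume p: "p \<in> Spec"
  \<comment> \<open>The claim is symmetric in \<open>q\<close> and \<open>r\<close>, so antisymmetry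
    turns it into uniqueness.\<close>
  have le: "q \<le> r" if q: "q \<in> Min_Spec" "q \<le> p" and r: "r \<in> Min_Spec" "r \<le> p" for q r
  proof (rule le_if_compact_le, rule ccontr)
    fix c assume c: "c \<in> compact_elements" "c \<le> q" "\<not> c \<le> r"
    \<comment> \<open>Otherwise some prime below \<open>q\<close> would not be above
      \<open>c\<close>; by minimality it would be \<open>q\<close>, which is above
      \<open>c\<close>.\<close>
    have "\<not> annihilator c \<le> q"
      using ex_Spec_below_not_above[OF PF_imp_semiprime[OF assms] Min_SpecD[OF q(1)] c(1)]
        c(2) Min_Spec_eq[OF q(1)] by blast
    then obtain d where d: "d \<in> compact_elements" "d \<le> annihilator c" "\<not> d \<le> q"
      using le_if_compact_le by blast
    have "sup (annihilator c) (annihilator d) = top"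
      using annihilator_pure[OF c(1)] d by (simp add: pure_def)
    \<comment> \<open>\<open>c\<close> escapes \<open>r\<close> and \<open>d\<close> escapes
      \<open>q\<close>, so their annihilators lie below \<open>r\<close> and \<open>q\<close>
      respectively, hence below \<open>p\<close>.\<close>
    moreover have "annihilator c \<le> p" "annihilator d \<le> p"
      using Spec_annihilator_le[OF Min_SpecD] q r c d order_trans by meson+
    ultimately have "top \<le> p" by (metis sup_least)
    with Spec_less_top[OF p] show False by (simp add: less_le_not_le)
  qed
  show "\<exists>!q. q \<in> Min_Spec \<and> q \<le> p"
    using Min_Spec_below[OF p] le by (blast intro: order_antisym)
qed

lemma semiprime_mp_imp_PF:
  assumes semiprime: "semiprime_quantale (\<cdot>)" and "mp_quantale (\<cdot>)"
  shows "PF_quantale (\<cdot>)"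
proof unfold_locales
  interpret mp_quantale "(\<cdot>)" by (rule assms)
  \<comment> \<open>Otherwise some prime \<open>r\<close> below \<open>p\<close> is not above
    \<open>c\<close>; a minimal prime below \<open>r\<close> must be the unique \<open>q\<close>,
    which puts \<open>c\<close> below \<open>r\<close>.\<close>
  have not_le: "\<not> annihilator c \<le> p"
    if p: "p \<in> Spec" and c: "c \<in> compact_elements" and q: "q \<in> Min_Spec" "q \<le> p" "c \<le> q" for c p q
  proof
    assume "annihilator c \<le> p"
    then obtain r where r: "r \<in> Spec" "r \<le> p" "\<not> c \<le> r"
      using ex_Spec_below_not_above[OF semiprime p c] by blast
    then obtain q' where q': "q' \<in> Min_Spec" "q' \<le> r" using Min_Spec_below by blast
    have "q' \<le> p" using q'(2) r(2) by (rule order_trans)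
    with q q' have "q' = q" using unique_minimal[OF p] by blast
    with q(3) q'(2) have "c \<le> r" using order_trans by blast
    with r(3) show False ..
  qed
  fix c :: 'a assume c: "c \<in> compact_elements"
  show "pure (annihilator c)"
    unfolding pure_def
  proof (intro ballI impI, rule ccontr)
    fix d assume d: "d \<in> compact_elements" "d \<le> annihilator c"
      and "sup (annihilator c) (annihilator d) \<noteq> top"
    then obtain p where p: "p \<in> Spec" "sup (annihilator c) (annihilator d) \<le> p"
      using ex_Spec_above[of "sup (annihilator c) (annihilator d)"] by (auto simp: less_top)
    obtain q where q: "q \<in> Min_Spec" "q \<le> p" using Min_Spec_below[OF p(1)] by blast
    \<comment> \<open>The product is \<open>bot\<close>, so the minimal prime \<open>q\<close> is
      above \<open>c\<close> or \<open>d\<close>; in either case \<open>not_le\<close> excludes the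
      corresponding annihilator from lying below \<open>p\<close>.\<close>
    have "c \<cdot> d \<le> q" using d(2) by (simp add: le_annihilator_iff)
    then have "c \<le> q \<or> d \<le> q" using Spec_mult_le_iff[OF Min_SpecD[OF q(1)]] by blast
    then show False using not_le[OF p(1) _ q] c d(1) p(2) by auto
  qed
qed

end

theorem theorem8p19:
  fixes mult :: "'a::complete_lattice \<Rightarrow> 'a \<Rightarrow> 'a"
  assumes "coherent_quantale mult"
  shows "PF_quantale mult \<longleftrightarrow> semiprime_quantale mult \<and> mp_quantale mult"
proof -
  interpret coherent_quantale mult by (rule assms)
  show ?thesis
    by (intro iffI conjI; (elim conjE)?) (fact PF_imp_semiprime PF_imp_mp semiprime_mp_imp_PF)+
qed

end
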